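(* Let $p$ be a prime and $R$ a (commutative, unital) ring of characteristic $p$. Let $T: R[y] \to R[y]$ be an $R$-linear operator that lowers degrees ($\deg T(f) < \deg f$ for all nonzero $f$), such that the sequence $\{T(y^n)\}_{n\geq 0}$ satisfies an $R[y]$-linear recursion whose companion polynomial has the form $$X^d + a y^d + (\text{terms of total degree} \leq d - D)$$ for some integers $d \geq 1$, $D \geq 1$ and some constant $a \in R$. Let $b \geq d$ be a power of $p$ with $b - D \geq 2$, and suppose that either $b - d \leq 1$ or $D \leq b/2$. Then $$N_T(y^n) \ll n^{\alpha}, \qquad \alpha = \frac{\log(b - D)}{\log b}.$$
   Context: A sequence $\{s_n\}$ in $R[y]$ satisfies the $R[y]$-linear recursion with companion polynomial $X^d - a_1 X^{d-1} - \cdots - a_d \in R[y][X]$ if $s_n = a_1 s_{n-1} + \cdots + a_d s_{n-d}$ for all $n \geq d$. Total degree is in the variables $y, X$. $\deg 0 = -\infty$. For locally nilpotent $T$ and $f \neq 0$, $N_T(f) := \max\{k \geq 0: T^k f \neq 0\}$. $g \ll h$ means $g(n) \leq Ch(n)$ for a constant $C$ and all large $n$. *)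

theory Defs
  imports "HOL-Computational_Algebra.Computational_Algebra" Complex_Main
begin

text \<open>
  For a commutative ring \<open>R\<close> given as a type \<open>'a\<close>, the ring \<open>R[y]\<close> is the type \<open>'a poly\<close> and
  \<open>R[y][X]\<close> is the type \<open>'a poly poly\<close>: the outer variable is \<open>X\<close>, the inner one is \<open>y\<close>, so
  \<open>coeff (coeff Q i) j\<close> is the coefficient of \<open>X^i y^j\<close> in \<open>Q\<close>, and \<open>[:monom a d:]\<close> is \<open>a y^d\<close>.
\<close>

definition companion_poly :: "nat \<Rightarrow> (nat \<Rightarrow> 'r) \<Rightarrow> 'r :: comm_ring_1 poly" where
  "companion_poly d c = monom 1 d - (\<Sum>i=1..d. monom (c i) (d - i))"

definition satisfies_recursion :: "(nat \<Rightarrow> 'r) \<Rightarrow> 'r :: comm_ring_1 poly \<Rightarrow> bool" where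
  "satisfies_recursion s P \<longleftrightarrow>
     (\<exists>d c. P = companion_poly d c \<and> (\<forall>n\<ge>d. s n = (\<Sum>i=1..d. c i * s (n - i))))"

text \<open>
  The bound is an integer: if it is negative, the condition forces \<open>Q = 0\<close>, in accordance
  with \<open>deg 0 = -\<infinity>\<close>.
\<close>

definition terms_total_degree_le :: "'a :: zero poly poly \<Rightarrow> int \<Rightarrow> bool" where
  "terms_total_degree_le Q k \<longleftrightarrow>
     (\<forall>i j. coeff (coeff Q i) j \<noteq> 0 \<longrightarrow> int i + int j \<le> k)"

text \<open>
  The library sets \<open>degree 0 = 0\<close>, so the case \<open>T f = 0\<close> (degree \<open>-\<infinity>\<close>) is listed separately.
  In particular such a \<open>T\<close> annihilates the constants.
\<close>

definition lowers_degrees :: "('a :: zero poly \<Rightarrow> 'a poly) \<Rightarrow> bool" where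
  "lowers_degrees T \<longleftrightarrow> (\<forall>f. f \<noteq> 0 \<longrightarrow> T f = 0 \<or> degree (T f) < degree f)"

text \<open>
  Meaningful only for \<open>f \<noteq> 0\<close> and locally nilpotent linear \<open>T\<close>, where the set is finite and
  contains \<open>0\<close>. A linear degree-lowering \<open>T\<close> is locally nilpotent.
\<close>

definition nilpotence_index :: "('b \<Rightarrow> 'b :: zero) \<Rightarrow> 'b \<Rightarrow> nat" where
  "nilpotence_index T f = Max {k. (T ^^ k) f \<noteq> 0}"

end

theory Submission imports Defs begin

text \<open>
  Give \<open>y^n\<close> a weight \<open>w n\<close> by expanding \<open>n div d\<close> in base \<open>b\<close>, reading the digits in base
  \<open>\<beta> = b - D\<close>, multiplying by \<open>d\<close> and adding \<open>n mod d\<close>. Since \<open>\<beta> \<le> b\<close>, carries do not increase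
  the weight, so \<open>w\<close> is subadditive, and \<open>w n\<close> is \<open>O(n powr \<alpha>)\<close>. It remains to see that \<open>T\<close> strictly
  lowers \<open>w\<close>. For \<open>q\<close> a power of \<open>b\<close>, the Frobenius map turns the companion polynomial \<open>P\<close> into
  \<open>P^q\<close>, whose monomials are \<open>X^(i q) y^(j q)\<close> with \<open>(i, j) = (0, d)\<close> or \<open>i + j \<le> d - D\<close>. If the
  digit of \<open>n div d\<close> at \<open>q\<close> is nonzero, then \<open>n - d q\<close> has weight exactly \<open>w n - w (d q)\<close>, so the
  induction reduces to \<open>w (i q) + w (j q) \<le> w (d q)\<close>. This follows from
  \<open>(d - D) * w (i q) \<le> i * w (d q)\<close>, an induction on the exponent of \<open>q\<close> that only uses
  \<open>i * b div d \<ge> i\<close>.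
\<close>

section \<open>Digit weights\<close>

text \<open>The guard \<open>b < 2\<close> only secures termination; for \<open>b \<ge> 2\<close>
  the case split disappears again in \<open>digit_content_rec\<close>.\<close>

function digit_content :: "nat \<Rightarrow> nat \<Rightarrow> nat \<Rightarrow> nat" where
  "digit_content b \<beta> n = (if n < b \<or> b < 2 then n else \<beta> * digit_content b \<beta> (n div b) + n mod b)"
  by pat_completeness auto
termination
  by (relation "measure (\<lambda>(b, \<beta>, n). n)") (auto intro!: div_less_dividend)

declare digit_content.simps [simp del]

lemma digit_content_less: "n < b \<Longrightarrow> digit_content b \<beta> n = n"
  by (subst digit_content.simps) simp

lemma digit_content_0 [simp]: "digit_content b \<beta> 0 = 0"
  by (subst digit_content.simps) simp

lemma digit_content_rec:
  assumes "b \<ge> 2"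
  shows "digit_content b \<beta> n = \<beta> * digit_content b \<beta> (n div b) + n mod b"
  using assms by (cases "n < b") (simp_all add: digit_content_less digit_content.simps[of b \<beta> n])

lemma digit_content_power_mult:
  assumes "b \<ge> 2"
  shows "digit_content b \<beta> (b ^ k * n) = \<beta> ^ k * digit_content b \<beta> n"
proof (induction k)
  case (Suc k)
  have "digit_content b \<beta> (b ^ Suc k * n) = \<beta> * digit_content b \<beta> (b ^ Suc k * n div b) + (b ^ Suc k * n) mod b"
    by (rule digit_content_rec[OF assms])
  also have "b ^ Suc k * n div b = b ^ k * n"
    using assms by (simp add: mult.assoc)
  also have "(b ^ Suc k * n) mod b = 0"
    by simp
  finally show ?case
    using Suc by simp
qed simp

lemma digit_content_le_self:
  assumes "b \<ge> 2" "\<beta> \<le> b"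
  shows "digit_content b \<beta> n \<le> n"
proof (induction n rule: less_induct)
  case (less n)
  show ?case
  proof (cases "n < b")
    case False
    then have "n div b < n"
      using assms by (intro div_less_dividend) auto
    then have "\<beta> * digit_content b \<beta> (n div b) \<le> b * (n div b)"
      using less assms by (intro mult_mono) auto
    then show ?thesis
      using digit_content_rec[OF assms(1), of \<beta> n] mult_div_mod_eq[of b n] by linarith
  qed (simp add: digit_content_less)
qed

lemma add_div_mod_carry:
  fixes b :: nat
  assumes "b > 0"
  obtains t where "t \<le> 1" "(m + n) div b = m div b + n div b + t"
    "(m + n) mod b + b * t = m mod b + n mod b"
proof -
  define t where "t = (m mod b + n mod b) div b"
  have "m mod b + n mod b < b * 2"
    using assms mod_less_divisor[of b m] mod_less_divisor[of b n] by linarith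
  then have "t < 2"
    unfolding t_def using assms by (simp add: less_mult_imp_div_less mult.commute)
  moreover have "(m + n) div b = m div b + n div b + t"
    unfolding t_def by (rule div_add1_eq)
  moreover have "(m + n) mod b + b * t = m mod b + n mod b"
    unfolding t_def using mod_mult_div_eq[of "m mod b + n mod b" b] by (simp add: mod_add_eq)
  ultimately show ?thesis
    using that[of t] by linarith
qed

text \<open>A carry trades b units of the last place for one unit of the quotient, which costs at
  most \<beta> \<le> b. The induction hypothesis is used twice: to detach the carry \<open>t\<close>
  from the quotients, then to separate the quotients.\<close>

lemma digit_content_add_le:
  assumes b: "b \<ge> 2" and le: "\<beta> \<le> b"
  shows "digit_content b \<beta> (m + n) \<le> digit_content b \<beta> m + digit_content b \<beta> n"
proof (induction "m + n" arbitrary: m n rule: less_induct)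
  case less
  show ?case
  proof (cases "m + n = 0")
    case False
    obtain t where t: "t \<le> 1" "(m + n) div b = m div b + n div b + t"
      "(m + n) mod b + b * t = m mod b + n mod b"
      using add_div_mod_carry[of b m n] b by auto
    have lt: "(m + n) div b < m + n"
      using b False by (intro div_less_dividend) auto
    have "digit_content b \<beta> (m div b + n div b + t) \<le> digit_content b \<beta> (m div b + n div b) + digit_content b \<beta> t"
      using lt t(2) by (intro less) auto
    also have "digit_content b \<beta> (m div b + n div b) \<le> digit_content b \<beta> (m div b) + digit_content b \<beta> (n div b)"
      using lt t(2) by (intro less) auto
    also have "digit_content b \<beta> t = t"
      using t(1) b by (intro digit_content_less) auto
    finally have "\<beta> * digit_content b \<beta> ((m + n) div b)
        \<le> \<beta> * (digit_content b \<beta> (m div b) + digit_content b \<beta> (n div b) + t)"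
      using t(2) by (intro mult_left_mono) auto
    also have "\<dots> \<le> \<beta> * digit_content b \<beta> (m div b) + \<beta> * digit_content b \<beta> (n div b) + b * t"
      using le by (simp add: algebra_simps)
    finally show ?thesis
      using t(3) digit_content_rec[OF b, of \<beta> "m + n"] digit_content_rec[OF b, of \<beta> m]
        digit_content_rec[OF b, of \<beta> n] by linarith
  qed simp
qed

text \<open>Lowering a nonzero digit by one causes no borrow, so the drop is exact. The induction
  lowers the leading digit.\<close>

lemma digit_content_remove_digit:
  assumes b: "b \<ge> 2" and "n > 0"
  obtains k where "b ^ k \<le> n" "digit_content b \<beta> n = digit_content b \<beta> (n - b ^ k) + \<beta> ^ k"
proof -
  have "\<exists>k. b ^ k \<le> n \<and> digit_content b \<beta> n = digit_content b \<beta> (n - b ^ k) + \<beta> ^ k"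
    using \<open>n > 0\<close>
  proof (induction n rule: less_induct)
    case (less n)
    show ?case
    proof (cases "n < b")
      case True
      then show ?thesis
        using less.prems by (intro exI[of _ 0]) (simp add: digit_content_less)
    next
      case False
      then have "n div b < n" "n div b > 0"
        using b by (auto intro!: div_less_dividend simp: div_greater_zero_iff)
      then obtain k where k: "b ^ k \<le> n div b"
        "digit_content b \<beta> (n div b) = digit_content b \<beta> (n div b - b ^ k) + \<beta> ^ k"
        using less.IH by blast
      have le: "b ^ Suc k \<le> n"
        using mult_le_mono2[OF k(1), of b] times_div_less_eq_dividend[of b n]
        unfolding power_Suc by linarith
      then obtain x where n: "n = b * b ^ k + x"
        using le_Suc_ex by auto
      then have x: "n - b ^ Suc k = x"
        by simp
      have "n div b = b ^ k + x div b" "n mod b = x mod b"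
        using b unfolding n by simp_all
      then have "digit_content b \<beta> n = digit_content b \<beta> (n - b ^ Suc k) + \<beta> ^ Suc k"
        using k(2) digit_content_rec[OF b, of \<beta> n] digit_content_rec[OF b, of \<beta> x]
        unfolding x by (simp add: distrib_left)
      with le show ?thesis
        by blast
    qed
  qed
  then show ?thesis
    using that by blast
qed

section \<open>Weights of exponents\<close>

text \<open>Dividing by d first makes an index shift by d b^k, the order of the recursion attached
  to P^(b^k), act on a single digit and leave the remainder alone.\<close>

definition weight :: "nat \<Rightarrow> nat \<Rightarrow> nat \<Rightarrow> nat \<Rightarrow> nat" where
  "weight d b \<beta> n = d * digit_content b \<beta> (n div d) + n mod d"

lemma weight_less: "n < d \<Longrightarrow> weight d b \<beta> n = n"
  by (simp add: weight_def)

lemma weight_le_self: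
  assumes "b \<ge> 2" "\<beta> \<le> b"
  shows "weight d b \<beta> n \<le> n"
proof -
  have "d * digit_content b \<beta> (n div d) \<le> d * (n div d)"
    by (intro mult_le_mono2 digit_content_le_self assms)
  then show ?thesis
    unfolding weight_def using mult_div_mod_eq[of d n] by linarith
qed

lemma weight_mult_power:
  assumes "b \<ge> 2" "d > 0"
  shows "weight d b \<beta> (d * b ^ k) = d * \<beta> ^ k"
  using assms digit_content_power_mult[of b \<beta> k 1] by (simp add: weight_def digit_content_less)

lemma weight_add_le:
  assumes "b \<ge> 2" "\<beta> \<le> b" "d > 0"
  shows "weight d b \<beta> (m + n) \<le> weight d b \<beta> m + weight d b \<beta> n"
proof -
  obtain t where t: "t \<le> 1" "(m + n) div d = m div d + n div d + t"
    "(m + n) mod d + d * t = m mod d + n mod d"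
    using add_div_mod_carry[OF assms(3)] by blast
  have "digit_content b \<beta> (m div d + n div d + t)
      \<le> digit_content b \<beta> (m div d) + digit_content b \<beta> (n div d) + digit_content b \<beta> t"
    using digit_content_add_le[OF assms(1,2), of "m div d + n div d" t]
      digit_content_add_le[OF assms(1,2), of "m div d" "n div d"] by linarith
  also have "digit_content b \<beta> t = t"
    using t(1) assms(1) by (intro digit_content_less) auto
  finally have "d * digit_content b \<beta> ((m + n) div d)
      \<le> d * (digit_content b \<beta> (m div d) + digit_content b \<beta> (n div d) + t)"
    using t(2) by (intro mult_le_mono2) simp
  then show ?thesis
    unfolding weight_def using t(3) by (simp add: algebra_simps)
qed

lemma weight_power_mult_le:
  assumes b: "b \<ge> 2" "d > 0" "d \<le> b" "D \<le> d"
  shows "(d - D) * weight d b (b - D) (i * b ^ k) \<le> i * (d * (b - D) ^ k)"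
proof (induction k arbitrary: i)
  case 0
  have "(d - D) * weight d b (b - D) i \<le> d * i"
    using weight_le_self[OF b(1), of "b - D" d i] by (intro mult_le_mono) auto
  then show ?case
    by (simp add: mult.commute)
next
  case (Suc k)
  define I where "I = i * b div d"
  define r where "r = i * b mod d"
  have split: "i * b = d * I + r"
    unfolding I_def r_def by simp
  \<comment> \<open>This is where d \<le> b enters. It makes the loss D I below at least D i, which
    turns b into b - D.\<close>
  have "I \<ge> i"
    unfolding I_def using b by (simp add: less_eq_div_iff_mult_less_eq)
  have top: "weight d b (b - D) (d * I * b ^ k) \<le> d * (I * (b - D) ^ k)"
  proof -
    have "digit_content b (b - D) (b ^ k * I) \<le> (b - D) ^ k * I"
      using digit_content_power_mult[OF b(1)] digit_content_le_self[OF b(1), of "b - D" I] by simp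
    moreover have "d * I * b ^ k = d * (b ^ k * I)"
      by simp
    ultimately show ?thesis
      unfolding weight_def using b(2) by (simp add: mult.commute)
  qed
  have "i * b ^ Suc k = d * I * b ^ k + r * b ^ k"
    using split by (metis add_mult_distrib mult.assoc power_Suc)
  then have "weight d b (b - D) (i * b ^ Suc k)
      \<le> d * (I * (b - D) ^ k) + weight d b (b - D) (r * b ^ k)"
    using weight_add_le[OF b(1) _ b(2), of "b - D" "d * I * b ^ k" "r * b ^ k"] top by simp
  then have "(d - D) * weight d b (b - D) (i * b ^ Suc k)
      \<le> (d - D) * (d * (I * (b - D) ^ k) + weight d b (b - D) (r * b ^ k))"
    by (rule mult_le_mono2)
  also have "\<dots> \<le> (d - D) * (d * (I * (b - D) ^ k)) + r * (d * (b - D) ^ k)"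
    unfolding distrib_left by (rule add_left_mono[OF Suc])
  also have "\<dots> = ((d - D) * I + r) * (d * (b - D) ^ k)"
    by (simp add: algebra_simps)
  also have "(d - D) * I + r \<le> i * (b - D)"
  proof -
    have "(d - D) * I + r = i * b - D * I"
      using split \<open>D \<le> d\<close> by (simp add: diff_mult_distrib)
    also have "\<dots> \<le> i * b - D * i"
      using \<open>I \<ge> i\<close> by (intro diff_le_mono2) simp
    finally show ?thesis
      by (simp add: diff_mult_distrib2 mult.commute)
  qed
  finally show ?case
    by (simp add: mult_ac)
qed

text \<open>The pair (0, d) gives equality. Otherwise the two bounds from
  \<open>weight_power_mult_le\<close> are added and d - D is cancelled. This needs D < d, which
  holds once i or j is nonzero; if both vanish, so do the weights.\<close>

lemma weight_exponents_le:
  assumes b: "b \<ge> 2" "d > 0" "d \<le> b" and ij: "i = 0 \<and> j = d \<or> i + j + D \<le> d"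
  shows "weight d b (b - D) (i * b ^ k) + weight d b (b - D) (j * b ^ k) \<le> d * (b - D) ^ k"
proof (cases "i = 0")
  case True
  note z = True
  show ?thesis
  proof (cases "j = d")
    case True
    then show ?thesis
      using z weight_mult_power[OF b(1,2)] b(2) by (simp add: weight_less)
  next
    case False
    then have "j + D \<le> d"
      using z ij by simp
    show ?thesis
    proof (cases "j = 0")
      case True
      then show ?thesis
        using z b(2) by (simp add: weight_less)
    next
      case False
      have "(d - D) * weight d b (b - D) (j * b ^ k) \<le> j * (d * (b - D) ^ k)"
        using \<open>j + D \<le> d\<close> by (intro weight_power_mult_le b) auto
      also have "\<dots> \<le> (d - D) * (d * (b - D) ^ k)"
        using \<open>j + D \<le> d\<close> by (intro mult_le_mono1) simp
      finally show ?thesis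
        using z b(2) False \<open>j + D \<le> d\<close> by (simp add: weight_less)
    qed
  qed
next
  case False
  then have le: "i + j + D \<le> d"
    using ij by simp
  have "(d - D) * weight d b (b - D) (i * b ^ k) \<le> i * (d * (b - D) ^ k)"
    "(d - D) * weight d b (b - D) (j * b ^ k) \<le> j * (d * (b - D) ^ k)"
    using le by (intro weight_power_mult_le b; linarith)+
  then have "(d - D) * (weight d b (b - D) (i * b ^ k) + weight d b (b - D) (j * b ^ k))
      \<le> (i + j) * (d * (b - D) ^ k)"
    by (simp only: distrib_left distrib_right add_mono)
  also have "\<dots> \<le> (d - D) * (d * (b - D) ^ k)"
    using le by (intro mult_le_mono1) simp
  finally show ?thesis
    using False le by simp
qed

lemma weight_remove_digit:
  assumes "b \<ge> 2" "d > 0" "n \<ge> d"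
  obtains k where "d * b ^ k \<le> n" "weight d b \<beta> n = weight d b \<beta> (n - d * b ^ k) + d * \<beta> ^ k"
proof -
  have "n div d > 0"
    using assms by (simp add: div_greater_zero_iff)
  then obtain k where k: "b ^ k \<le> n div d"
    "digit_content b \<beta> (n div d) = digit_content b \<beta> (n div d - b ^ k) + \<beta> ^ k"
    using digit_content_remove_digit[OF assms(1)] by blast
  have le: "d * b ^ k \<le> n"
    using mult_le_mono2[OF k(1), of d] times_div_less_eq_dividend[of d n] by linarith
  then obtain x where n: "n = d * b ^ k + x"
    using le_Suc_ex by blast
  then have x: "n - d * b ^ k = x"
    by simp
  have "n div d = b ^ k + x div d" "n mod d = x mod d"
    using assms(2) unfolding n by simp_all
  then have "weight d b \<beta> n = weight d b \<beta> (n - d * b ^ k) + d * \<beta> ^ k"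
    using k(2) unfolding weight_def x by (simp add: distrib_left)
  with le that show ?thesis
    by blast
qed

section \<open>Growth of the weight\<close>

text \<open>The summand b strengthens the induction: it absorbs the last digit, so that one digit
  step multiplies the left side by at most \<beta>. On the right that step is matched by b^\<alpha>
  = \<beta>.\<close>

lemma digit_content_le_powr:
  assumes \<beta>: "\<beta> \<ge> 2" "\<beta> \<le> b" and "n \<ge> 1"
  shows "real (digit_content b \<beta> n) + real b \<le> 2 * real b * real n powr (ln (real \<beta>) / ln (real b))"
  using \<open>n \<ge> 1\<close>
proof (induction n rule: less_induct)
  case (less n)
  define \<alpha> where "\<alpha> = ln (real \<beta>) / ln (real b)"
  have b: "b \<ge> 2"
    using \<beta> by simp
  have "\<alpha> \<ge> 0"
    unfolding \<alpha>_def using \<beta> by simp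
  have b\<alpha>: "real b powr \<alpha> = real \<beta>"
    unfolding \<alpha>_def using \<beta> by (simp add: powr_def)
  show ?case
    unfolding \<alpha>_def[symmetric]
  proof (cases "n < b")
    case True
    have "1 \<le> real n powr \<alpha>"
      using less.prems \<open>\<alpha> \<ge> 0\<close> by (intro ge_one_powr_ge_zero) auto
    then have "2 * real b * 1 \<le> 2 * real b * real n powr \<alpha>"
      by (intro mult_left_mono) auto
    then show "real (digit_content b \<beta> n) + real b \<le> 2 * real b * real n powr \<alpha>"
      using True unfolding digit_content_less[OF True] by linarith
  next
    case False
    have *: "n div b < n" "n div b \<ge> 1"
      using b False less.prems by (auto intro!: div_less_dividend simp: Suc_le_eq div_greater_zero_iff)
    have "real \<beta> * (real (digit_content b \<beta> (n div b)) + real b)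
        \<le> real \<beta> * (2 * real b * real (n div b) powr \<alpha>)"
      using less.IH[OF *] unfolding \<alpha>_def[symmetric] by (intro mult_left_mono) auto
    also have "real (n div b) powr \<alpha> \<le> (real n / real b) powr \<alpha>"
      using \<open>\<alpha> \<ge> 0\<close> of_nat_div_le_of_nat[of n b] by (intro powr_mono2) auto
    also have "(real n / real b) powr \<alpha> = real n powr \<alpha> / real \<beta>"
      using b by (simp add: powr_divide b\<alpha>)
    finally have le: "real \<beta> * (real (digit_content b \<beta> (n div b)) + real b)
        \<le> 2 * real b * real n powr \<alpha>"
      using \<beta> by simp
    have "n mod b < b"
      using b by simp
    \<comment> \<open>Here \<beta> \<ge> 2 is used: the last digit together with b is at most 2
      b.\<close>
    moreover have "2 * b \<le> \<beta> * b"
      using \<beta> by (intro mult_le_mono1)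
    ultimately have "n mod b + b \<le> \<beta> * b"
      by linarith
    then have "digit_content b \<beta> n + b \<le> \<beta> * (digit_content b \<beta> (n div b) + b)"
      unfolding digit_content_rec[OF b, of \<beta> n] by (simp add: algebra_simps)
    then have "real (digit_content b \<beta> n + b) \<le> real (\<beta> * (digit_content b \<beta> (n div b) + b))"
      by (rule of_nat_mono)
    then show "real (digit_content b \<beta> n) + real b \<le> 2 * real b * real n powr \<alpha>"
      using le by simp
  qed
qed

lemma weight_le_powr:
  assumes \<beta>: "\<beta> \<ge> 2" "\<beta> \<le> b" and d: "d > 0" and "n \<ge> 1"
  shows "real (weight d b \<beta> n)
    \<le> real d * (2 * real b + 1) * real n powr (ln (real \<beta>) / ln (real b))"
proof -
  define \<alpha> where "\<alpha> = ln (real \<beta>) / ln (real b)"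
  have "\<alpha> \<ge> 0"
    unfolding \<alpha>_def using \<beta> by simp
  have one: "1 \<le> real n powr \<alpha>"
    using \<open>n \<ge> 1\<close> \<open>\<alpha> \<ge> 0\<close> by (intro ge_one_powr_ge_zero) auto
  have "real (digit_content b \<beta> (n div d)) \<le> 2 * real b * real n powr \<alpha>"
  proof (cases "n div d = 0")
    case False
    then have "real (digit_content b \<beta> (n div d)) + real b \<le> 2 * real b * real (n div d) powr \<alpha>"
      unfolding \<alpha>_def using \<beta> by (intro digit_content_le_powr) auto
    also have "\<dots> \<le> 2 * real b * real n powr \<alpha>"
      using \<open>\<alpha> \<ge> 0\<close> by (intro mult_left_mono powr_mono2) (auto simp: div_le_dividend)
    finally show ?thesis
      by simp
  qed simp
  then have "real d * real (digit_content b \<beta> (n div d)) \<le> real d * (2 * real b * real n powr \<alpha>)"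
    by (intro mult_left_mono) auto
  moreover have "real (n mod d) \<le> real d * real n powr \<alpha>"
  proof -
    have "real (n mod d) \<le> real d * 1"
      using d by (simp add: less_imp_le)
    also have "\<dots> \<le> real d * real n powr \<alpha>"
      using one by (intro mult_left_mono) auto
    finally show ?thesis .
  qed
  ultimately show ?thesis
    unfolding \<alpha>_def[symmetric] weight_def by (simp add: algebra_simps)
qed

section \<open>Linear recursions as polynomial annihilators\<close>

text \<open>This is the module structure on sequences in which X acts as the shift: the value at m
  of A(X) applied to s. A linear recursion becomes annihilation by its companion polynomial.\<close>

definition shift_act :: "'r :: comm_ring_1 poly \<Rightarrow> (nat \<Rightarrow> 'r) \<Rightarrow> nat \<Rightarrow> 'r" where
  "shift_act A s m = (\<Sum>i\<le>degree A. coeff A i * s (m + i))"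

lemma shift_act_eq:
  assumes "degree A \<le> N"
  shows "shift_act A s m = (\<Sum>i\<le>N. coeff A i * s (m + i))"
  unfolding shift_act_def using assms
  by (intro sum.mono_neutral_left) (auto simp: coeff_eq_0)

lemma shift_act_0 [simp]: "shift_act 0 s m = 0"
  by (simp add: shift_act_def)

lemma shift_act_add: "shift_act (A + B) s m = shift_act A s m + shift_act B s m"
proof -
  define N where "N = max (degree A) (degree B)"
  have "degree (A + B) \<le> N" "degree A \<le> N" "degree B \<le> N"
    unfolding N_def by (auto intro: degree_add_le)
  then show ?thesis
    by (simp add: shift_act_eq sum.distrib algebra_simps)
qed

lemma shift_act_sum: "shift_act (\<Sum>i\<in>I. A i) s m = (\<Sum>i\<in>I. shift_act (A i) s m)"
  by (induction I rule: infinite_finite_induct) (simp_all add: shift_act_add)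

lemma shift_act_smult: "shift_act (smult c A) s m = c * shift_act A s m"
  by (subst shift_act_eq[OF degree_smult_le]) (simp add: shift_act_def sum_distrib_left mult_ac)

lemma shift_act_pCons: "shift_act (pCons c A) s m = c * s m + shift_act A s (Suc m)"
  by (subst shift_act_eq[OF degree_pCons_le])
    (simp add: shift_act_def sum.atMost_Suc_shift del: sum.atMost_Suc)

lemma shift_act_monom: "shift_act (monom c k) s m = c * s (m + k)"
  by (induction k arbitrary: m) (simp_all add: monom_0 monom_Suc shift_act_pCons)

text \<open>Annihilators of a sequence form an ideal. Multiplication by X moves the index, so
  vanishing is assumed at every m.\<close>

lemma shift_act_mult_eq_0:
  assumes "\<And>m. shift_act A s m = 0"
  shows "shift_act (G * A) s m = 0"
proof (induction G arbitrary: m)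
  case (pCons a G)
  then show ?case
    by (simp add: shift_act_add shift_act_smult shift_act_pCons assms)
qed simp

section \<open>Frobenius powers\<close>

text \<open>Additivity of Frobenius leaves no mixed terms. It is applied over R[y] to powers of P,
  and over R to powers of the coefficients of P.\<close>

lemma poly_frobenius_power:
  fixes A :: "'r :: comm_ring_1 poly"
  assumes "prime CHAR('r)"
  shows "A ^ (CHAR('r) ^ r) = (\<Sum>i\<le>degree A. monom (coeff A i ^ (CHAR('r) ^ r)) (i * CHAR('r) ^ r))"
proof -
  have "A ^ (CHAR('r) ^ r) = (\<Sum>i\<le>degree A. monom (coeff A i) i) ^ (CHAR('r) ^ r)"
    by (simp add: poly_as_sum_of_monoms)
  also have "\<dots> = (\<Sum>i\<le>degree A. monom (coeff A i) i ^ (CHAR('r) ^ r))"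
    by (rule freshmans_dream_sum') (use assms in simp_all)
  finally show ?thesis
    by (simp add: monom_power mult.commute)
qed

text \<open>Only this direction is available in general: R may have nilpotents, so a nonzero
  coefficient can die in the power.\<close>

lemma coeff_frobenius_power_nonzero:
  fixes A :: "'r :: comm_ring_1 poly"
  assumes "prime CHAR('r)" "coeff (A ^ (CHAR('r) ^ r)) e \<noteq> 0"
  obtains j where "e = j * CHAR('r) ^ r" "coeff A j \<noteq> 0"
proof -
  have "(\<Sum>i\<le>degree A. coeff (monom (coeff A i ^ (CHAR('r) ^ r)) (i * CHAR('r) ^ r)) e) \<noteq> 0"
    using assms by (simp add: poly_frobenius_power coeff_sum)
  then obtain j where "coeff (monom (coeff A j ^ (CHAR('r) ^ r)) (j * CHAR('r) ^ r)) e \<noteq> 0"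
    by (meson sum.neutral)
  then have "j * CHAR('r) ^ r = e" "coeff A j ^ (CHAR('r) ^ r) \<noteq> 0"
    by (simp_all add: coeff_monom split: if_splits)
  moreover from this(2) have "coeff A j \<noteq> 0"
    using assms(1) by (auto simp: power_0_left)
  ultimately show ?thesis
    using that by blast
qed

lemma coeff_companion_poly:
  "coeff (companion_poly d c) i = (if i = d then 1 else if i < d then - c (d - i) else 0)"
proof -
  have "coeff (companion_poly d c) i
      = (if i = d then 1 else 0) - (\<Sum>j=1..d. if d - j = i then c j else 0)"
    unfolding companion_poly_def by (simp add: coeff_sum coeff_monom)
  also have "(\<Sum>j=1..d. if d - j = i then c j else 0) = (\<Sum>j=1..d. if i < d \<and> j = d - i then c j else 0)"
    by (intro sum.cong) auto
  also have "\<dots> = (if i < d then c (d - i) else 0)"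
    by (cases "i < d") auto
  finally show ?thesis
    by auto
qed

lemma degree_companion_poly [simp]: "degree (companion_poly d c) = d"
  by (intro antisym degree_le le_degree) (auto simp: coeff_companion_poly)

lemma shift_act_eq_0_if_satisfies_recursion:
  assumes "satisfies_recursion s P"
  shows "shift_act P s m = 0"
proof -
  obtain d c where P: "P = companion_poly d c"
    and rec: "\<And>n. n \<ge> d \<Longrightarrow> s n = (\<Sum>i=1..d. c i * s (n - i))"
    using assms unfolding satisfies_recursion_def by blast
  have "shift_act P s m = (\<Sum>i\<le>d. coeff P i * s (m + i))"
    by (simp add: shift_act_def P)
  also have "{..d} = insert d {..<d}"
    by auto
  also have "(\<Sum>i\<in>insert d {..<d}. coeff P i * s (m + i))
      = s (m + d) - (\<Sum>i<d. c (d - i) * s (m + i))"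
    by (simp add: P coeff_companion_poly sum_negf)
  also have "(\<Sum>i<d. c (d - i) * s (m + i)) = (\<Sum>i=1..d. c i * s (m + d - i))"
    by (rule sum.reindex_bij_witness[of _ "\<lambda>i. d - i" "\<lambda>i. d - i"]) auto
  finally show ?thesis
    using rec[of "m + d"] by simp
qed

lemma lead_coeff_if_satisfies_recursion:
  assumes "satisfies_recursion s P"
  shows "lead_coeff P = 1"
  using assms unfolding satisfies_recursion_def by (auto simp: coeff_companion_poly)

text \<open>P divides P^q, so P^q annihilates s as well; by Frobenius it involves only powers of
  X^q, and it is still monic.\<close>

lemma recursion_frobenius:
  fixes P :: "'r :: comm_ring_1 poly"
  assumes "prime CHAR('r)" "satisfies_recursion s P" and q: "q = CHAR('r) ^ r"
  shows "s (m + degree P * q) = - (\<Sum>i<degree P. coeff P i ^ q * s (m + i * q))"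
proof -
  have "q > 0"
    using assms(1) q by (simp add: prime_gt_0_nat)
  have "P ^ q = P ^ (q - 1) * P"
    using \<open>q > 0\<close> by (metis power_minus_mult)
  then have "0 = shift_act (P ^ q) s m"
    by (simp add: shift_act_mult_eq_0 shift_act_eq_0_if_satisfies_recursion[OF assms(2)])
  also have "\<dots> = (\<Sum>i\<le>degree P. coeff P i ^ q * s (m + i * q))"
    unfolding q by (simp add: poly_frobenius_power[OF assms(1)] shift_act_sum shift_act_monom)
  also have "{..degree P} = insert (degree P) {..<degree P}"
    by auto
  finally show ?thesis
    using lead_coeff_if_satisfies_recursion[OF assms(2)] by (simp add: eq_neg_iff_add_eq_0)
qed

section \<open>Weights and nilpotence\<close>

lemma coeff_mult_nonzero:
  fixes A B :: "'r :: comm_semiring_0 poly"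
  assumes "coeff (A * B) t \<noteq> 0"
  obtains e l where "t = e + l" "coeff A e \<noteq> 0" "coeff B l \<noteq> 0"
proof -
  have "(\<Sum>e\<le>t. coeff A e * coeff B (t - e)) \<noteq> 0"
    using assms by (simp add: coeff_mult)
  then obtain e where e: "e \<le> t" "coeff A e * coeff B (t - e) \<noteq> 0"
    by (meson sum.neutral atMost_iff)
  then have "coeff A e \<noteq> 0" "coeff B (t - e) \<noteq> 0"
    by auto
  with e(1) show ?thesis
    using that[of e "t - e"] by simp
qed

lemma recursion_operator_lowers_weight:
  fixes T :: "'a :: comm_ring_1 poly \<Rightarrow> 'a poly"
  assumes p: "prime CHAR('a)" and b: "b = CHAR('a) ^ r" "b \<ge> 2" "d > 0" "d \<le> b"
    and low: "lowers_degrees T"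
    and rec: "satisfies_recursion (\<lambda>n. T (monom 1 n)) P" and deg: "degree P = d"
    and supp: "\<And>i j. i < d \<Longrightarrow> coeff (coeff P i) j \<noteq> 0 \<Longrightarrow> i = 0 \<and> j = d \<or> i + j + D \<le> d"
    and "coeff (T (monom 1 n)) t \<noteq> 0"
  shows "weight d b (b - D) t < weight d b (b - D) n"
  using \<open>coeff (T (monom 1 n)) t \<noteq> 0\<close>
proof (induction n arbitrary: t rule: less_induct)
  case (less n)
  let ?w = "weight d b (b - D)"
  show ?case
  proof (cases "n < d")
    \<comment> \<open>No recursion reaches these n, but below d the weight is the identity, so
      lowering degrees is enough.\<close>
    case True
    have "T (monom 1 n) \<noteq> 0" "(monom 1 n :: 'a poly) \<noteq> 0"
      using less.prems by auto
    then have "degree (T (monom 1 n)) < n"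
      using low unfolding lowers_degrees_def by (metis degree_monom_eq one_neq_zero)
    moreover have "t \<le> degree (T (monom 1 n))"
      using less.prems by (rule le_degree)
    ultimately show ?thesis
      using True by (simp add: weight_less)
  next
    case False
    then obtain k where k: "d * b ^ k \<le> n" "?w n = ?w (n - d * b ^ k) + d * (b - D) ^ k"
      using weight_remove_digit[OF b(2,3)] by (metis not_less)
    define q where "q = b ^ k"
    define m where "m = n - d * q"
    have n: "n = m + d * q"
      using k(1) by (simp add: m_def q_def)
    \<comment> \<open>The recursion has coefficients in R[y], so Frobenius is needed for
      \<open>'a poly\<close>, which has the same characteristic as R.\<close>
    have q: "q = CHAR('a poly) ^ (r * k)" "q > 0"
      using b p by (simp_all add: q_def power_mult prime_gt_0_nat)
    have "T (monom 1 n) = - (\<Sum>i<d. coeff P i ^ q * T (monom 1 (m + i * q)))"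
      using recursion_frobenius[of "\<lambda>n. T (monom 1 n)" P q "r * k" m] p rec q(1) deg n by simp
    then have "(\<Sum>i<d. coeff (coeff P i ^ q * T (monom 1 (m + i * q))) t) \<noteq> 0"
      using less.prems by (simp add: coeff_sum)
    \<comment> \<open>Tracing y^t back: it arises from a monomial X^(i q) y^(j q) of P^q and a
      monomial y^l of T(y^(m + i q)), with t = j q + l.\<close>
    then obtain i where i: "i < d" "coeff (coeff P i ^ q * T (monom 1 (m + i * q))) t \<noteq> 0"
      by (meson sum.neutral lessThan_iff)
    obtain e l where t: "t = e + l" and e: "coeff (coeff P i ^ q) e \<noteq> 0"
      and l: "coeff (T (monom 1 (m + i * q))) l \<noteq> 0"
      using i(2) by (rule coeff_mult_nonzero)
    obtain j where j: "e = j * q" "coeff (coeff P i) j \<noteq> 0"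
      using coeff_frobenius_power_nonzero[OF p, of "coeff P i" "r * k" e] e q(1) by auto
    \<comment> \<open>The chain is w t \<le> w (j q) + w l < w (j q) + w (m + i q) \<le> w m + d
      \<beta>^k = w n with \<beta> = b - D; strictness comes from the induction hypothesis.\<close>
    have "?w l < ?w (m + i * q)"
      using i(1) q(2) by (intro less.IH l) (simp add: n)
    moreover have "?w (m + i * q) \<le> ?w m + ?w (i * q)" "?w t \<le> ?w (j * q) + ?w l"
      unfolding t j(1) using b by (intro weight_add_le; simp)+
    moreover have "?w (i * q) + ?w (j * q) \<le> d * (b - D) ^ k"
      unfolding q_def using supp[OF i(1) j(2)] b by (intro weight_exponents_le) auto
    ultimately show ?thesis
      using k(2) unfolding m_def q_def by linarith
  qed
qed

section \<open>From weights to nilpotence\<close>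

text \<open>Each application of T lowers the strict weight bound on the support by one; at bound 0
  no monomial remains.\<close>

lemma funpow_eq_0_if_weight_less:
  fixes T :: "'a :: comm_ring_1 poly \<Rightarrow> 'a poly" and w :: "nat \<Rightarrow> nat"
  assumes T: "module_hom smult smult T"
    and low: "\<And>n t. coeff (T (monom 1 n)) t \<noteq> 0 \<Longrightarrow> w t < w n"
    and "\<And>l. coeff f l \<noteq> 0 \<Longrightarrow> w l < v"
  shows "(T ^^ v) f = 0"
  using assms(3)
proof (induction v arbitrary: f)
  case 0
  then have "coeff f l = 0" for l
    by blast
  then show ?case
    by (simp add: poly_eq_iff)
next
  case (Suc v)
  interpret module_hom smult smult T
    by (rule T)
  have "T f = T (\<Sum>l\<le>degree f. smult (coeff f l) (monom 1 l))"
    by (simp add: smult_monom poly_as_sum_of_monoms)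
  then have Tf: "T f = (\<Sum>l\<le>degree f. smult (coeff f l) (T (monom 1 l)))"
    by (simp only: sum scale)
  have "w t < v" if "coeff (T f) t \<noteq> 0" for t
  proof -
    have "(\<Sum>l\<le>degree f. coeff f l * coeff (T (monom 1 l)) t) \<noteq> 0"
      using that unfolding Tf by (simp add: coeff_sum)
    then obtain l where "coeff f l * coeff (T (monom 1 l)) t \<noteq> 0"
      by (meson sum.neutral)
    then have "coeff f l \<noteq> 0" "coeff (T (monom 1 l)) t \<noteq> 0"
      by auto
    then show ?thesis
      using low[of l t] Suc.prems[of l] by linarith
  qed
  then have "(T ^^ v) (T f) = 0"
    by (rule Suc.IH)
  then show ?case
    by (simp add: funpow_swap1)
qed

lemma nilpotence_index_le_weight:
  fixes T :: "'a :: comm_ring_1 poly \<Rightarrow> 'a poly" and w :: "nat \<Rightarrow> nat"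
  assumes T: "module_hom smult smult T"
    and low: "\<And>n t. coeff (T (monom 1 n)) t \<noteq> 0 \<Longrightarrow> w t < w n"
  shows "nilpotence_index T (monom 1 n) \<le> w n"
proof -
  let ?K = "{k. (T ^^ k) (monom 1 n) \<noteq> 0}"
  have sub: "?K \<subseteq> {..w n}"
  proof
    fix k assume "k \<in> ?K"
    moreover have "(T ^^ k) (monom 1 n) = 0" if "k > w n"
      by (rule funpow_eq_0_if_weight_less[OF T, of w])
        (use that low in \<open>auto split: if_splits\<close>)
    ultimately show "k \<in> {..w n}"
      by (auto simp: not_le[symmetric])
  qed
  \<comment> \<open>\<open>Max\<close> is informative only on a finite nonempty set: finiteness
    comes from \<open>sub\<close>, nonemptiness from y^n being nonzero.\<close>
  have "0 \<in> ?K"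
    by simp
  then have "Max ?K \<in> ?K"
    using finite_subset[OF sub] by (intro Max_in) blast+
  with sub show ?thesis
    unfolding nilpotence_index_def by blast
qed

lemma coeff_companion_decomposition:
  fixes Q :: "'a :: comm_ring_1 poly poly"
  assumes P: "P = monom 1 d + [:monom a d:] + Q"
    and Q: "terms_total_degree_le Q (int d - int D)" and "d \<ge> 1" "D \<ge> 1"
  shows "degree P = d"
    and "i < d \<Longrightarrow> coeff (coeff P i) j \<noteq> 0 \<Longrightarrow> i = 0 \<and> j = d \<or> i + j + D \<le> d"
proof -
  have Qz: "i + j + D \<le> d" if "coeff (coeff Q i) j \<noteq> 0" for i j
    using Q that unfolding terms_total_degree_le_def by fastforce
  \<comment> \<open>As D \<ge> 1, Q has no terms in X^d or above, so P is monic of degree d. If D >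
    d, the negative bound makes Q vanish.\<close>
  then have Q0: "coeff Q i = 0" if "i \<ge> d" for i
    using that \<open>D \<ge> 1\<close> by (intro poly_eqI) (force simp: not_le)
  have cP: "coeff P i = (if i = d then 1 else 0) + (if i = 0 then monom a d else 0) + coeff Q i" for i
    unfolding P by (cases i) (auto simp: coeff_monom)
  show "degree P = d"
    using \<open>d \<ge> 1\<close> by (intro antisym degree_le le_degree) (auto simp: cP Q0)
  show "i = 0 \<and> j = d \<or> i + j + D \<le> d" if "i < d" "coeff (coeff P i) j \<noteq> 0"
    using that Qz[of i j] by (auto simp: cP coeff_monom split: if_splits)
qed

theorem theorem6p2:
  fixes T :: "'a :: comm_ring_1 poly \<Rightarrow> 'a poly"
    and a :: 'a
    and p d D b :: nat
    and P Q :: "'a poly poly"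
  assumes "prime p"
    and "CHAR('a) = p"
    and "module_hom smult smult T"
    and "lowers_degrees T"
    and "d \<ge> 1"
    and "D \<ge> 1"
    and "satisfies_recursion (\<lambda>n. T (monom 1 n)) P"
    and "P = monom 1 d + [:monom a d:] + Q"
    and "terms_total_degree_le Q (int d - int D)"
    and "b \<ge> d"
    and "\<exists>k. b = p ^ k"
    and "int b - int D \<ge> 2"
    and "int b - int d \<le> 1 \<or> real D \<le> real b / 2"
  shows "\<exists>C::real. \<forall>\<^sub>F n in sequentially.
           real (nilpotence_index T (monom 1 n))
             \<le> C * real n powr (ln (real b - real D) / ln (real b))"
proof -
  obtain r where r: "b = CHAR('a) ^ r"
    using assms(2,11) by blast
  \<comment> \<open>The integer hypothesis makes the truncated difference \<open>b - D\<close>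
    exact, so the digit base agrees with the real number in the exponent.\<close>
  have bD: "b - D \<ge> 2" "b - D \<le> b" "real b - real D = real (b - D)"
    using assms(12) by auto
  have low: "weight d b (b - D) t < weight d b (b - D) n" if "coeff (T (monom 1 n)) t \<noteq> 0" for n t
  proof (rule recursion_operator_lowers_weight[OF _ r _ _ \<open>b \<ge> d\<close> assms(4,7) _ _ that])
    show "degree P = d"
      by (rule coeff_companion_decomposition[OF assms(8,9,5,6)])
    show "i = 0 \<and> j = d \<or> i + j + D \<le> d" if "i < d" "coeff (coeff P i) j \<noteq> 0" for i j
      by (rule coeff_companion_decomposition(2)[OF assms(8,9,5,6) that])
  qed (use assms bD in auto)
  have "real (nilpotence_index T (monom 1 n))
      \<le> real d * (2 * real b + 1) * real n powr (ln (real b - real D) / ln (real b))" if "n \<ge> 1" for n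
  proof -
    have "real (nilpotence_index T (monom 1 n)) \<le> real (weight d b (b - D) n)"
      using nilpotence_index_le_weight[OF assms(3), of "weight d b (b - D)" n] low by simp
    also have "\<dots> \<le> real d * (2 * real b + 1) * real n powr (ln (real (b - D)) / ln (real b))"
      using bD assms(5) that by (intro weight_le_powr) auto
    finally show ?thesis
      by (simp only: bD)
  qed
  then show ?thesis
    by (intro exI[of _ "real d * (2 * real b + 1)"] eventually_sequentiallyI[of 1])
qed

end
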